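(* Let $\phi(\mathbf{x},\mathbf{y})$ and $\psi(\mathbf{x},\mathbf{z})$ be quantifier-free formulas of polynomial arithmetic over the reals with common variables $\mathbf{x}$, and let $m$ be a positive integer. Suppose the solution sets $[\![\phi]\!]$ and $[\![\psi]\!]$ are bounded, and suppose there exists an interpolant $I_0\in\mathbb{R}[\mathbf{x}]_m$ of $\phi$ and $\psi$ which, viewed as a hyperplane in the feature space $\mathbb{R}^{\tilde d}$, separates the images of $[\![\phi]\!]$ and $[\![\psi]\!]$ (projected to $\mathbf{x}$) with positive functional margin $\gamma>0$. Then NIL$(\phi,\psi,m)$ (assuming exact, infinite-precision computations) terminates and returns an interpolant $I$ of $\phi$ and $\psi$.
   Context: Formulas are built from atoms $p(\mathbf{x})\diamond 0$ with $p$ a real polynomial and $\diamond\in\{<,>,\le,\ge,=\}$ using $\wedge,\vee,\neg$; $[\![\phi]\!]$ is the set of real points satisfying $\phi$. $\mathbb{R}[\mathbf{x}]_m$ denotes polynomials of degree $\le m$ and $I\in\mathbb{R}[\mathbf{x}]_m$ means $I$ is $p(\mathbf{x})\diamond 0$ with $p\in\mathbb{R}[\mathbf{x}]_m$. Given $\phi,\psi$ with $\phi\wedge\psi$ unsatisfiable, $I$ is an interpolant if $\phi\models I$, $I\wedge\psi$ is unsatisfiable, and $I$ contains only symbols common to $\phi$ and $\psi$. Feature space: $\Phi:\mathbb{R}^d\to\mathbb{R}^{\tilde d}$ maps $\mathbf{x}$ to the vector of monomials in $\mathbf{x}$ of degree $\le m$, so a polynomial of degree $\le m$ corresponds to an affine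 function $\vec w^{T}\Phi(\mathbf{x})+b$, i.e. a hyperplane in $\mathbb{R}^{\tilde d}$. The functional margin of a hyperplane $\vec w^{T}\vec u+b=0$ separating sets of points is $2\min_i |\vec w^{T}\vec u_i+b|/\|\vec w\|$ (infimum over the points $\vec u_i$ of the sets), i.e. twice the distance from the hyperplane to the nearest point. Algorithm NIL$(\phi,\psi,m)$: (1) if $\phi\wedge\psi$ is satisfiable, abort. (2) Obtain finite initial sample sets $X^+\subseteq[\![\phi]\!]$ and $X^-\subseteq[\![\psi]\!]$ projected onto $\mathbf{x}$. (3) Repeat: compute by an SVM with polynomial kernel $(\beta\mathbf{x}^T\mathbf{x}'+\theta)^m$ the maximum-functional-margin hyperplane in $\mathbb{R}^{\tilde d}$ separating $\Phi(X^+)$ from $\Phi(X^-)$; if none exists, abort; else let $I$ be the corresponding polynomial inequality of degree $\le m$. If $\phi\models I$ and $I\wedge\psi$ is unsatisfiable, return $I$; else add to $X^+$ (projected) points satisfying $\phi\wedge\neg I$ and to $X^-$ points satisfying $I\wedge\psi$, and repeat. *)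

theory Defs
  imports "HOL-Analysis.Analysis" "HOL-Library.Poly_Mapping" "HOL-Library.FuncSet"
begin

text \<open>A monomial is a finitely supported exponent map, a polynomial a finitely supported
  coefficient map on monomials; the variables have an arbitrary type.\<close>

type_synonym 'v monomial = "'v \<Rightarrow>\<^sub>0 nat"
type_synonym 'v rpoly = "'v monomial \<Rightarrow>\<^sub>0 real"

definition mono_degree :: "'v monomial \<Rightarrow> nat" where
  "mono_degree \<mu> = (\<Sum>v\<in>Poly_Mapping.keys \<mu>. Poly_Mapping.lookup \<mu> v)"

definition mono_eval :: "('v \<Rightarrow> real) \<Rightarrow> 'v monomial \<Rightarrow> real" where
  "mono_eval \<sigma> \<mu> = (\<Prod>v\<in>Poly_Mapping.keys \<mu>. \<sigma> v ^ Poly_Mapping.lookup \<mu> v)"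

definition poly_eval :: "('v \<Rightarrow> real) \<Rightarrow> 'v rpoly \<Rightarrow> real" where
  "poly_eval \<sigma> p = (\<Sum>\<mu>\<in>Poly_Mapping.keys p. Poly_Mapping.lookup p \<mu> * mono_eval \<sigma> \<mu>)"

definition poly_vars :: "'v rpoly \<Rightarrow> 'v set" where
  "poly_vars p = (\<Union>\<mu>\<in>Poly_Mapping.keys p. Poly_Mapping.keys \<mu>)"

definition monomials_upto :: "'v set \<Rightarrow> nat \<Rightarrow> 'v monomial set" where
  "monomials_upto X m = {\<mu>. Poly_Mapping.keys \<mu> \<subseteq> X \<and> mono_degree \<mu> \<le> m}"

definition polys_upto :: "'v set \<Rightarrow> nat \<Rightarrow> 'v rpoly set" where
  "polys_upto X m = {p. Poly_Mapping.keys p \<subseteq> monomials_upto X m}"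

datatype cmp = Lt | Gt | Le | Ge | Eq

fun cmp_zero :: "cmp \<Rightarrow> real \<Rightarrow> bool" where
  "cmp_zero Lt a \<longleftrightarrow> a < 0"
| "cmp_zero Gt a \<longleftrightarrow> a > 0"
| "cmp_zero Le a \<longleftrightarrow> a \<le> 0"
| "cmp_zero Ge a \<longleftrightarrow> a \<ge> 0"
| "cmp_zero Eq a \<longleftrightarrow> a = 0"

datatype 'v fm =
    Atom cmp "'v rpoly"
  | And "'v fm" "'v fm"
  | Or "'v fm" "'v fm"
  | Neg "'v fm"

fun fvars :: "'v fm \<Rightarrow> 'v set" where
  "fvars (Atom r p) = poly_vars p"
| "fvars (And f g) = fvars f \<union> fvars g"
| "fvars (Or f g) = fvars f \<union> fvars g"
| "fvars (Neg f) = fvars f"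

fun holds :: "('v \<Rightarrow> real) \<Rightarrow> 'v fm \<Rightarrow> bool" where
  "holds \<sigma> (Atom r p) \<longleftrightarrow> cmp_zero r (poly_eval \<sigma> p)"
| "holds \<sigma> (And f g) \<longleftrightarrow> holds \<sigma> f \<and> holds \<sigma> g"
| "holds \<sigma> (Or f g) \<longleftrightarrow> holds \<sigma> f \<or> holds \<sigma> g"
| "holds \<sigma> (Neg f) \<longleftrightarrow> \<not> holds \<sigma> f"

definition satisfiable :: "'v fm \<Rightarrow> bool" where
  "satisfiable f \<longleftrightarrow> (\<exists>\<sigma>. holds \<sigma> f)"

definition entails :: "'v fm \<Rightarrow> 'v fm \<Rightarrow> bool" where
  "entails f g \<longleftrightarrow> (\<forall>\<sigma>. holds \<sigma> f \<longrightarrow> holds \<sigma> g)"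

text \<open>The points of $R^V$ are the extensional functions on \<open>V\<close>. Only the variables that occur in
  a formula are coordinates of its solution set; otherwise boundedness would fail trivially.\<close>

definition solutions :: "'v fm \<Rightarrow> ('v \<Rightarrow> real) set" where
  "solutions f = {\<sigma> \<in> fvars f \<rightarrow>\<^sub>E UNIV. holds \<sigma> f}"

definition bounded_solutions :: "'v fm \<Rightarrow> bool" where
  "bounded_solutions f \<longleftrightarrow> (\<exists>B. \<forall>\<sigma>\<in>solutions f. L2_set \<sigma> (fvars f) \<le> B)"

definition common_vars :: "'v fm \<Rightarrow> 'v fm \<Rightarrow> 'v set" where
  "common_vars \<phi> \<psi> = fvars \<phi> \<inter> fvars \<psi>"

definition proj_solutions :: "'v set \<Rightarrow> 'v fm \<Rightarrow> ('v \<Rightarrow> real) set" where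
  "proj_solutions X f = (\<lambda>\<sigma>. restrict \<sigma> X) ` solutions f"

definition interpolant :: "'v fm \<Rightarrow> 'v fm \<Rightarrow> 'v fm \<Rightarrow> bool" where
  "interpolant \<phi> \<psi> I \<longleftrightarrow>
     entails \<phi> I \<and> \<not> satisfiable (And I \<psi>) \<and> fvars I \<subseteq> common_vars \<phi> \<psi>"

text \<open>The feature space is the Euclidean space whose coordinates are the monomials in \<open>X\<close> of
  degree at most \<open>m\<close>; only the values of a vector on \<open>monomials_upto X m\<close> matter. The monomials
  carry the positive scaling under which the standard inner product is the polynomial kernel
  $(\beta x^T x' + \theta)^m$ (lemma \<open>feature_kernel\<close> below).\<close>

type_synonym 'v fvec = "'v monomial \<Rightarrow> real"

definition feature_weight :: "real \<Rightarrow> real \<Rightarrow> nat \<Rightarrow> 'v monomial \<Rightarrow> real" where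
  "feature_weight \<beta> \<theta> m \<mu> =
     sqrt (fact m / (fact (m - mono_degree \<mu>) *
             (\<Prod>v\<in>Poly_Mapping.keys \<mu>. fact (Poly_Mapping.lookup \<mu> v)))
           * \<beta> ^ mono_degree \<mu> * \<theta> ^ (m - mono_degree \<mu>))"

definition feature_map :: "'v set \<Rightarrow> real \<Rightarrow> real \<Rightarrow> nat \<Rightarrow> ('v \<Rightarrow> real) \<Rightarrow> 'v fvec" where
  "feature_map X \<beta> \<theta> m x =
     (\<lambda>\<mu>\<in>monomials_upto X m. feature_weight \<beta> \<theta> m \<mu> * mono_eval x \<mu>)"

definition feature_inner :: "'v set \<Rightarrow> nat \<Rightarrow> 'v fvec \<Rightarrow> 'v fvec \<Rightarrow> real" where
  "feature_inner X m w u = (\<Sum>\<mu>\<in>monomials_upto X m. w \<mu> * u \<mu>)"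

text \<open>The polynomial that corresponds to the affine function $w^T \Phi(x) + b$.\<close>

definition hyperplane_poly ::
    "'v set \<Rightarrow> real \<Rightarrow> real \<Rightarrow> nat \<Rightarrow> 'v fvec \<Rightarrow> real \<Rightarrow> 'v rpoly" where
  "hyperplane_poly X \<beta> \<theta> m w b =
     (\<Sum>\<mu>\<in>monomials_upto X m. Poly_Mapping.single \<mu> (w \<mu> * feature_weight \<beta> \<theta> m \<mu>))
     + Poly_Mapping.single 0 b"

definition separates ::
    "'v set \<Rightarrow> nat \<Rightarrow> 'v fvec \<Rightarrow> real \<Rightarrow> 'v fvec set \<Rightarrow> 'v fvec set \<Rightarrow> bool" where
  "separates X m w b U V \<longleftrightarrow>
     (\<forall>u\<in>U. feature_inner X m w u + b > 0) \<and> (\<forall>v\<in>V. feature_inner X m w v + b < 0)"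

text \<open>Extended reals are used because \<open>U\<close> may be empty. For $w = 0$, $b \neq 0$ (the hyperplane
  at infinity) the margin is \<open>\<infinity>\<close>; such a pair never separates two nonempty sets, and it is the
  maximum-margin solution when exactly one of the two classes is empty.\<close>

definition functional_margin ::
    "'v set \<Rightarrow> nat \<Rightarrow> 'v fvec \<Rightarrow> real \<Rightarrow> 'v fvec set \<Rightarrow> ereal" where
  "functional_margin X m w b U =
     (INF u\<in>U. ereal (2 * \<bar>feature_inner X m w u + b\<bar>) / ereal (L2_set w (monomials_upto X m)))"

definition max_margin_hyperplane ::
    "'v set \<Rightarrow> nat \<Rightarrow> 'v fvec set \<Rightarrow> 'v fvec set \<Rightarrow> 'v fvec \<Rightarrow> real \<Rightarrow> bool" where
  "max_margin_hyperplane X m U V w b \<longleftrightarrow>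
     separates X m w b U V \<and>
     (\<forall>w' b'. separates X m w' b' U V \<longrightarrow>
        functional_margin X m w' b' (U \<union> V) \<le> functional_margin X m w b (U \<union> V))"

text \<open>A state \<open>Loop P N\<close> holds the current positive and negative samples. Sampling is
  nondeterministic: the initial samples are arbitrary finite sets of projected solutions, and a
  refinement adds finitely many counterexamples, at least one in total. The returned inequality
  may be strict or non-strict.\<close>

datatype 'v nil_state =
    Start
  | Loop "('v \<Rightarrow> real) set" "('v \<Rightarrow> real) set"
  | Returned "'v fm"
  | Aborted

inductive nil_step ::
    "real \<Rightarrow> real \<Rightarrow> 'v fm \<Rightarrow> 'v fm \<Rightarrow> nat \<Rightarrow> 'v nil_state \<Rightarrow> 'v nil_state \<Rightarrow> bool"
  for \<beta> \<theta> :: real and \<phi> \<psi> :: "'v fm" and m :: nat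
  where
  start_abort:
    "satisfiable (And \<phi> \<psi>) \<Longrightarrow> nil_step \<beta> \<theta> \<phi> \<psi> m Start Aborted"
| start_sample:
    "\<lbrakk> \<not> satisfiable (And \<phi> \<psi>);
       finite P; P \<subseteq> proj_solutions (common_vars \<phi> \<psi>) \<phi>;
       finite N; N \<subseteq> proj_solutions (common_vars \<phi> \<psi>) \<psi> \<rbrakk>
     \<Longrightarrow> nil_step \<beta> \<theta> \<phi> \<psi> m Start (Loop P N)"
| svm_abort:
    "\<lbrakk> X = common_vars \<phi> \<psi>;
       \<nexists>w b. max_margin_hyperplane X m
          (feature_map X \<beta> \<theta> m ` P) (feature_map X \<beta> \<theta> m ` N) w b \<rbrakk>
     \<Longrightarrow> nil_step \<beta> \<theta> \<phi> \<psi> m (Loop P N) Aborted"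
| svm_return:
    "\<lbrakk> X = common_vars \<phi> \<psi>;
       max_margin_hyperplane X m
          (feature_map X \<beta> \<theta> m ` P) (feature_map X \<beta> \<theta> m ` N) w b;
       r \<in> {Gt, Ge};
       I = Atom r (hyperplane_poly X \<beta> \<theta> m w b);
       entails \<phi> I; \<not> satisfiable (And I \<psi>) \<rbrakk>
     \<Longrightarrow> nil_step \<beta> \<theta> \<phi> \<psi> m (Loop P N) (Returned I)"
| svm_refine:
    "\<lbrakk> X = common_vars \<phi> \<psi>;
       max_margin_hyperplane X m
          (feature_map X \<beta> \<theta> m ` P) (feature_map X \<beta> \<theta> m ` N) w b;
       r \<in> {Gt, Ge};
       I = Atom r (hyperplane_poly X \<beta> \<theta> m w b);
       \<not> (entails \<phi> I \<and> \<not> satisfiable (And I \<psi>));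
       finite P'; P' \<subseteq> proj_solutions X (And \<phi> (Neg I));
       finite N'; N' \<subseteq> proj_solutions X (And I \<psi>);
       P' \<union> N' \<noteq> {} \<rbrakk>
     \<Longrightarrow> nil_step \<beta> \<theta> \<phi> \<psi> m (Loop P N) (Loop (P \<union> P') (N \<union> N'))"

lemma mono_degree_on:
  assumes "finite X" "Poly_Mapping.keys \<mu> \<subseteq> X"
  shows "mono_degree \<mu> = (\<Sum>v\<in>X. Poly_Mapping.lookup \<mu> v)"
  unfolding mono_degree_def using assms
  by (intro sum.mono_neutral_left) (auto simp: in_keys_iff)

lemma keys_add_single:
  fixes \<mu> :: "'v monomial"
  assumes "Poly_Mapping.keys \<mu> \<subseteq> X"
  shows "Poly_Mapping.keys (\<mu> + Poly_Mapping.single v j) \<subseteq> insert v X"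
  using assms Poly_Mapping.keys_add[of \<mu> "Poly_Mapping.single v j"] by (auto split: if_splits)

lemma monomials_upto_insert:
  assumes X: "finite X" "v \<notin> X"
  shows "bij_betw (\<lambda>(j, \<mu>). \<mu> + Poly_Mapping.single v j)
           (SIGMA j:{..m}. monomials_upto X (m - j)) (monomials_upto (insert v X) m)"
proof (rule bij_betw_byWitness
    [where f' = "\<lambda>\<mu>. (Poly_Mapping.lookup \<mu> v, \<mu> - Poly_Mapping.single v (Poly_Mapping.lookup \<mu> v))"])
  show "\<forall>a\<in>SIGMA j:{..m}. monomials_upto X (m - j).
     (\<lambda>\<mu>. (Poly_Mapping.lookup \<mu> v, \<mu> - Poly_Mapping.single v (Poly_Mapping.lookup \<mu> v)))
       ((\<lambda>(j, \<mu>). \<mu> + Poly_Mapping.single v j) a) = a"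
  proof clarify
    fix j \<mu> assume "\<mu> \<in> monomials_upto X (m - j)"
    then have "Poly_Mapping.lookup \<mu> v = 0"
      using X by (auto simp: monomials_upto_def in_keys_iff subset_iff)
    then show "Poly_Mapping.lookup (\<mu> + Poly_Mapping.single v j) v = j \<and>
        \<mu> + Poly_Mapping.single v j -
          Poly_Mapping.single v (Poly_Mapping.lookup (\<mu> + Poly_Mapping.single v j) v) = \<mu>"
      by (simp add: lookup_add)
  qed
  show "\<forall>a'\<in>monomials_upto (insert v X) m.
     (\<lambda>(j, \<mu>). \<mu> + Poly_Mapping.single v j)
       (Poly_Mapping.lookup a' v, a' - Poly_Mapping.single v (Poly_Mapping.lookup a' v)) = a'"
    by (auto intro!: poly_mapping_eqI simp: lookup_add lookup_minus lookup_single when_def)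
  show "(\<lambda>(j, \<mu>). \<mu> + Poly_Mapping.single v j) ` (SIGMA j:{..m}. monomials_upto X (m - j))
      \<subseteq> monomials_upto (insert v X) m"
  proof clarify
    fix j \<mu> assume j: "j \<le> m" and mu: "\<mu> \<in> monomials_upto X (m - j)"
    have k: "Poly_Mapping.keys \<mu> \<subseteq> X" using mu by (simp add: monomials_upto_def)
    have "mono_degree (\<mu> + Poly_Mapping.single v j)
        = (\<Sum>x\<in>insert v X. Poly_Mapping.lookup (\<mu> + Poly_Mapping.single v j) x)"
      using X keys_add_single[OF k] by (intro mono_degree_on) auto
    also have "\<dots> = j + (\<Sum>x\<in>X. Poly_Mapping.lookup \<mu> x)"
    proof -
      have "Poly_Mapping.lookup (\<mu> + Poly_Mapping.single v j) v = j"
        using X k by (auto simp: lookup_add in_keys_iff subset_iff)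
      moreover have "Poly_Mapping.lookup (\<mu> + Poly_Mapping.single v j) x = Poly_Mapping.lookup \<mu> x"
        if "x \<in> X" for x
        using that X by (auto simp: lookup_add lookup_single when_def)
      ultimately show ?thesis using X by simp
    qed
    also have "\<dots> \<le> m"
      using mu j X k by (simp add: monomials_upto_def mono_degree_on[symmetric])
    finally show "\<mu> + Poly_Mapping.single v j \<in> monomials_upto (insert v X) m"
      using keys_add_single[OF k] by (simp add: monomials_upto_def)
  qed
  show "(\<lambda>\<mu>. (Poly_Mapping.lookup \<mu> v, \<mu> - Poly_Mapping.single v (Poly_Mapping.lookup \<mu> v))) `
      monomials_upto (insert v X) m \<subseteq> (SIGMA j:{..m}. monomials_upto X (m - j))"
  proof clarify
    fix \<mu> assume mu: "\<mu> \<in> monomials_upto (insert v X) m"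
    let ?n = "\<mu> - Poly_Mapping.single v (Poly_Mapping.lookup \<mu> v)"
    have k: "Poly_Mapping.keys ?n \<subseteq> X"
      using mu by (auto simp: monomials_upto_def in_keys_iff lookup_minus lookup_single when_def
          subset_iff split: if_splits)
    have "mono_degree ?n = (\<Sum>x\<in>X. Poly_Mapping.lookup ?n x)"
      using X k by (intro mono_degree_on)
    also have "\<dots> = (\<Sum>x\<in>X. Poly_Mapping.lookup \<mu> x)"
      using X by (intro sum.cong) (auto simp: lookup_minus lookup_single when_def)
    finally have d: "mono_degree ?n = (\<Sum>x\<in>X. Poly_Mapping.lookup \<mu> x)" .
    have "mono_degree \<mu> = (\<Sum>x\<in>insert v X. Poly_Mapping.lookup \<mu> x)"
      using X mu by (intro mono_degree_on) (auto simp: monomials_upto_def)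
    then have "Poly_Mapping.lookup \<mu> v + mono_degree ?n \<le> m"
      using d X mu by (simp add: monomials_upto_def)
    then show "Poly_Mapping.lookup \<mu> v \<in> {..m} \<and> ?n \<in> monomials_upto X (m - Poly_Mapping.lookup \<mu> v)"
      using k by (auto simp: monomials_upto_def)
  qed
qed

lemma monomials_upto_empty: "monomials_upto {} m = {0}"
  by (auto simp: monomials_upto_def mono_degree_def)

lemma finite_monomials_upto: "finite X \<Longrightarrow> finite (monomials_upto X m)"
proof (induction X arbitrary: m rule: finite_induct)
  case empty
  show ?case by (simp add: monomials_upto_empty)
next
  case (insert v X)
  then have "finite (SIGMA j:{..m}. monomials_upto X (m - j))" by auto
  then show ?case
    using bij_betw_finite[OF monomials_upto_insert[OF insert(1,2), of m]] by blast
qed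

lemma multinomial_monomials:
  fixes z :: "'v \<Rightarrow> real"
  assumes "finite X"
  shows "(\<Sum>\<mu>\<in>monomials_upto X m.
            fact m / (fact (m - mono_degree \<mu>) * (\<Prod>v\<in>X. fact (Poly_Mapping.lookup \<mu> v)))
            * (\<Prod>v\<in>X. z v ^ Poly_Mapping.lookup \<mu> v) * \<theta> ^ (m - mono_degree \<mu>))
         = ((\<Sum>v\<in>X. z v) + \<theta>) ^ m"
  using assms
proof (induction X arbitrary: m rule: finite_induct)
  case empty
  show ?case by (simp add: monomials_upto_empty mono_degree_def)
next
  case (insert v X)
  let ?t = "\<lambda>X m \<mu>. fact m / (fact (m - mono_degree \<mu>) * (\<Prod>v\<in>X. fact (Poly_Mapping.lookup \<mu> v)))
            * (\<Prod>v\<in>X. z v ^ Poly_Mapping.lookup \<mu> v) * \<theta> ^ (m - mono_degree \<mu>)"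
  have term_split: "?t (insert v X) m (\<mu> + Poly_Mapping.single v j)
      = real (m choose j) * z v ^ j * ?t X (m - j) \<mu>"
    if j: "j \<le> m" and mu: "\<mu> \<in> monomials_upto X (m - j)" for j \<mu>
  proof -
    let ?n = "\<mu> + Poly_Mapping.single v j"
    have k: "Poly_Mapping.keys \<mu> \<subseteq> X" using mu by (simp add: monomials_upto_def)
    have lv: "Poly_Mapping.lookup ?n v = j"
      using k insert(2) by (auto simp: lookup_add in_keys_iff subset_iff)
    have lx: "Poly_Mapping.lookup ?n x = Poly_Mapping.lookup \<mu> x" if "x \<in> X" for x
      using that insert(2) by (auto simp: lookup_add lookup_single when_def)
    have d: "mono_degree ?n = j + mono_degree \<mu>"
    proof -
      have "mono_degree ?n = (\<Sum>x\<in>insert v X. Poly_Mapping.lookup ?n x)"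
        using insert(1) keys_add_single[OF k] by (intro mono_degree_on) auto
      also have "\<dots> = j + (\<Sum>x\<in>X. Poly_Mapping.lookup \<mu> x)"
        using insert(1,2) by (simp add: lv lx)
      finally show ?thesis using insert(1) k by (simp add: mono_degree_on[symmetric])
    qed
    have p1: "(\<Prod>x\<in>insert v X. fact (Poly_Mapping.lookup ?n x))
        = (fact j :: real) * (\<Prod>x\<in>X. fact (Poly_Mapping.lookup \<mu> x))"
      using insert(1,2) by (simp add: lv lx)
    have p2: "(\<Prod>x\<in>insert v X. z x ^ Poly_Mapping.lookup ?n x)
        = z v ^ j * (\<Prod>x\<in>X. z x ^ Poly_Mapping.lookup \<mu> x)"
      using insert(1,2) by (simp add: lv lx)
    show ?thesis
      unfolding d p1 p2 binomial_fact[OF j] by (simp add: diff_diff_left mult_ac)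
  qed
  have "(\<Sum>\<mu>\<in>monomials_upto (insert v X) m. ?t (insert v X) m \<mu>)
      = (\<Sum>(j, \<mu>)\<in>(SIGMA j:{..m}. monomials_upto X (m - j)).
           ?t (insert v X) m (\<mu> + Poly_Mapping.single v j))"
    by (subst sum.reindex_bij_betw[OF monomials_upto_insert[OF insert(1,2)], symmetric])
      (simp add: case_prod_unfold)
  also have "\<dots> = (\<Sum>j\<le>m. \<Sum>\<mu>\<in>monomials_upto X (m - j).
           ?t (insert v X) m (\<mu> + Poly_Mapping.single v j))"
    using insert(1) by (intro sum.Sigma[symmetric]) (auto simp: finite_monomials_upto)
  also have "\<dots> = (\<Sum>j\<le>m. \<Sum>\<mu>\<in>monomials_upto X (m - j). real (m choose j) * z v ^ j * ?t X (m - j) \<mu>)"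
    by (intro sum.cong refl) (rule term_split, auto)
  also have "\<dots> = (\<Sum>j\<le>m. real (m choose j) * z v ^ j * ((\<Sum>v\<in>X. z v) + \<theta>) ^ (m - j))"
    unfolding insert.IH[symmetric] by (simp add: sum_distrib_left)
  also have "\<dots> = (z v + ((\<Sum>v\<in>X. z v) + \<theta>)) ^ m"
    by (simp add: binomial_ring)
  finally show ?case using insert(1,2) by (simp add: add.assoc)
qed

lemma feature_kernel:
  assumes "finite X" "\<beta> > 0" "\<theta> > 0"
  shows "feature_inner X m (feature_map X \<beta> \<theta> m x) (feature_map X \<beta> \<theta> m x')
       = (\<beta> * (\<Sum>v\<in>X. x v * x' v) + \<theta>) ^ m"
proof -
  have "feature_map X \<beta> \<theta> m x \<mu> * feature_map X \<beta> \<theta> m x' \<mu>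
      = fact m / (fact (m - mono_degree \<mu>) * (\<Prod>v\<in>X. fact (Poly_Mapping.lookup \<mu> v)))
        * (\<Prod>v\<in>X. (\<beta> * (x v * x' v)) ^ Poly_Mapping.lookup \<mu> v) * \<theta> ^ (m - mono_degree \<mu>)"
    if mu: "\<mu> \<in> monomials_upto X m" for \<mu>
  proof -
    have k: "Poly_Mapping.keys \<mu> \<subseteq> X" using mu by (simp add: monomials_upto_def)
    have f: "(\<Prod>v\<in>Poly_Mapping.keys \<mu>. fact (Poly_Mapping.lookup \<mu> v))
        = (\<Prod>v\<in>X. fact (Poly_Mapping.lookup \<mu> v) :: real)"
      using assms(1) k by (intro prod.mono_neutral_left) (auto simp: in_keys_iff)
    have e: "mono_eval y \<mu> = (\<Prod>v\<in>X. y v ^ Poly_Mapping.lookup \<mu> v)" for y :: "'a \<Rightarrow> real"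
      unfolding mono_eval_def using assms(1) k
      by (intro prod.mono_neutral_left) (auto simp: in_keys_iff)
    have "0 \<le> fact m / (fact (m - mono_degree \<mu>) *
             (\<Prod>v\<in>Poly_Mapping.keys \<mu>. fact (Poly_Mapping.lookup \<mu> v)))
           * \<beta> ^ mono_degree \<mu> * \<theta> ^ (m - mono_degree \<mu>)"
      using assms(2,3) by (intro mult_nonneg_nonneg divide_nonneg_nonneg prod_nonneg) auto
    then have w: "feature_weight \<beta> \<theta> m \<mu> * feature_weight \<beta> \<theta> m \<mu>
        = fact m / (fact (m - mono_degree \<mu>) * (\<Prod>v\<in>X. fact (Poly_Mapping.lookup \<mu> v)))
           * \<beta> ^ mono_degree \<mu> * \<theta> ^ (m - mono_degree \<mu>)"
      unfolding feature_weight_def f[symmetric] by (simp only: real_sqrt_mult_self abs_of_nonneg)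
    have b: "\<beta> ^ mono_degree \<mu> = (\<Prod>v\<in>X. \<beta> ^ Poly_Mapping.lookup \<mu> v)"
      using mono_degree_on[OF assms(1) k] by (simp add: power_sum)
    have "feature_map X \<beta> \<theta> m x \<mu> * feature_map X \<beta> \<theta> m x' \<mu>
        = (feature_weight \<beta> \<theta> m \<mu> * feature_weight \<beta> \<theta> m \<mu>) * (mono_eval x \<mu> * mono_eval x' \<mu>)"
      using mu by (simp add: feature_map_def)
    also have "\<dots> = fact m / (fact (m - mono_degree \<mu>) * (\<Prod>v\<in>X. fact (Poly_Mapping.lookup \<mu> v)))
        * (\<beta> ^ mono_degree \<mu> * (mono_eval x \<mu> * mono_eval x' \<mu>)) * \<theta> ^ (m - mono_degree \<mu>)"
      unfolding w by simp
    also have "\<beta> ^ mono_degree \<mu> * (mono_eval x \<mu> * mono_eval x' \<mu>)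
        = (\<Prod>v\<in>X. (\<beta> * (x v * x' v)) ^ Poly_Mapping.lookup \<mu> v)"
      unfolding b e by (simp add: power_mult_distrib prod.distrib)
    finally show ?thesis .
  qed
  then have "feature_inner X m (feature_map X \<beta> \<theta> m x) (feature_map X \<beta> \<theta> m x')
      = (\<Sum>\<mu>\<in>monomials_upto X m.
          fact m / (fact (m - mono_degree \<mu>) * (\<Prod>v\<in>X. fact (Poly_Mapping.lookup \<mu> v)))
        * (\<Prod>v\<in>X. (\<beta> * (x v * x' v)) ^ Poly_Mapping.lookup \<mu> v) * \<theta> ^ (m - mono_degree \<mu>))"
    unfolding feature_inner_def by (intro sum.cong refl) auto
  also have "\<dots> = ((\<Sum>v\<in>X. \<beta> * (x v * x' v)) + \<theta>) ^ m"
    by (rule multinomial_monomials[OF assms(1)])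
  finally show ?thesis by (simp add: sum_distrib_left)
qed

lemma poly_eval_superset:
  assumes "finite A" "Poly_Mapping.keys p \<subseteq> A"
  shows "poly_eval x p = (\<Sum>\<mu>\<in>A. Poly_Mapping.lookup p \<mu> * mono_eval x \<mu>)"
  unfolding poly_eval_def using assms
  by (intro sum.mono_neutral_left) (auto simp: in_keys_iff)

lemma zero_in_monomials_upto: "0 \<in> monomials_upto X m"
  by (simp add: monomials_upto_def mono_degree_def)

lemma lookup_hyperplane_poly:
  assumes "finite X"
  shows "Poly_Mapping.lookup (hyperplane_poly X \<beta> \<theta> m w b) \<mu>
       = (if \<mu> \<in> monomials_upto X m then w \<mu> * feature_weight \<beta> \<theta> m \<mu> else 0)
         + (if \<mu> = 0 then b else 0)"
  using finite_monomials_upto[OF assms]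
  by (simp add: hyperplane_poly_def lookup_add lookup_sum lookup_single when_def)

lemma hyperplane_poly_in_polys_upto:
  assumes "finite X"
  shows "hyperplane_poly X \<beta> \<theta> m w b \<in> polys_upto X m"
  unfolding polys_upto_def
proof (intro CollectI subsetI)
  fix \<mu> assume "\<mu> \<in> Poly_Mapping.keys (hyperplane_poly X \<beta> \<theta> m w b)"
  then show "\<mu> \<in> monomials_upto X m"
    using zero_in_monomials_upto[of X m]
    by (cases "\<mu> = 0") (auto simp: in_keys_iff lookup_hyperplane_poly[OF assms] split: if_splits)
qed

lemma poly_eval_hyperplane_poly:
  assumes "finite X"
  shows "poly_eval x (hyperplane_poly X \<beta> \<theta> m w b)
       = feature_inner X m w (feature_map X \<beta> \<theta> m x) + b"
proof -
  let ?A = "monomials_upto X m"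
  have A: "finite ?A" by (rule finite_monomials_upto[OF assms])
  have "poly_eval x (hyperplane_poly X \<beta> \<theta> m w b)
      = (\<Sum>\<mu>\<in>?A. Poly_Mapping.lookup (hyperplane_poly X \<beta> \<theta> m w b) \<mu> * mono_eval x \<mu>)"
    using A hyperplane_poly_in_polys_upto[OF assms]
    by (intro poly_eval_superset) (auto simp: polys_upto_def)
  also have "\<dots> = (\<Sum>\<mu>\<in>?A. w \<mu> * feature_map X \<beta> \<theta> m x \<mu> + (if \<mu> = 0 then b * mono_eval x \<mu> else 0))"
    by (intro sum.cong refl) (simp add: lookup_hyperplane_poly[OF assms] feature_map_def algebra_simps)
  also have "\<dots> = feature_inner X m w (feature_map X \<beta> \<theta> m x) + b"
    using A zero_in_monomials_upto[of X m]
    by (simp add: sum.distrib feature_inner_def mono_eval_def)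
  finally show ?thesis .
qed

lemma feature_weight_pos:
  assumes "\<beta> > 0" "\<theta> > 0"
  shows "feature_weight \<beta> \<theta> m \<mu> > 0"
  unfolding feature_weight_def using assms
  by (intro real_sqrt_gt_zero mult_pos_pos divide_pos_pos zero_less_power prod_pos) auto

lemma polys_upto_eq_hyperplane_polys:
  assumes "finite X" "\<beta> > 0" "\<theta> > 0"
  shows "polys_upto X m = {hyperplane_poly X \<beta> \<theta> m w b | w b. True}"
proof (intro equalityI subsetI)
  fix p assume p: "p \<in> polys_upto X m"
  have "p = hyperplane_poly X \<beta> \<theta> m (\<lambda>\<mu>. Poly_Mapping.lookup p \<mu> / feature_weight \<beta> \<theta> m \<mu>) 0"
  proof (rule poly_mapping_eqI)
    fix \<mu>
    show "Poly_Mapping.lookup p \<mu> = Poly_Mapping.lookup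
        (hyperplane_poly X \<beta> \<theta> m (\<lambda>\<mu>. Poly_Mapping.lookup p \<mu> / feature_weight \<beta> \<theta> m \<mu>) 0) \<mu>"
      using p feature_weight_pos[OF assms(2,3), of m \<mu>]
      by (auto simp: lookup_hyperplane_poly[OF assms(1)] polys_upto_def in_keys_iff subset_iff)
  qed
  then show "p \<in> {hyperplane_poly X \<beta> \<theta> m w b | w b. True}" by blast
next
  fix p assume "p \<in> {hyperplane_poly X \<beta> \<theta> m w b | w b. True}"
  then show "p \<in> polys_upto X m" using hyperplane_poly_in_polys_upto[OF assms(1)] by auto
qed

end

theory Submission
  imports Defs
begin

text \<open>If both sample sets are nonempty, the hyperplane of the given interpolant separates them
  with margin at least \<open>\<gamma>\<close>, hence so does the maximum-margin hyperplane. A refinement adds a point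
  on the wrong side of that hyperplane, so in feature space the point is at distance at least
  \<open>\<gamma>/2\<close> from all earlier samples of its own class. A run with infinitely many refinements would
  give an infinite \<open>\<gamma>/2\<close>-separated subset of a bounded subset of a finite-dimensional space.
  The loop never aborts because, on the unit sphere of normals, the width of the gap between the
  two finite classes is a continuous function and so attains its maximum.\<close>

section \<open>Compactness in finitely many coordinates\<close>

text \<open>Bolzano-Weierstrass for functions, with convergence only in the finitely many
  coordinates of \<open>A\<close>; what happens outside \<open>A\<close> is ignored.\<close>

lemma bounded_coordinates_subsequence:
  fixes u :: "nat \<Rightarrow> 'a \<Rightarrow> real"
  assumes "finite A" and bdd: "\<And>a. a \<in> A \<Longrightarrow> \<exists>B. \<forall>n. \<bar>u n a\<bar> \<le> B"
  obtains l s where "strict_mono s" "\<And>a. a \<in> A \<Longrightarrow> (\<lambda>n. u (s n) a) \<longlonglongrightarrow> l a"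
proof -
  have "bounded ((\<lambda>x. x a) ` range u)" if "a \<in> A" for a
    using bdd[OF that] by (auto simp: bounded_iff)
  then have "\<forall>d\<subseteq>A. \<exists>l s. strict_mono s \<and>
      (\<forall>e>0. \<forall>\<^sub>F n in sequentially. \<forall>a\<in>d. dist (u (s n) a) (l a) < e)"
    by (intro compact_lemma_general[where unproj = "\<lambda>x. x"] \<open>finite A\<close>) auto
  from this[rule_format, OF subset_refl] obtain l s where s: "strict_mono s"
    and l: "\<forall>e>0. \<forall>\<^sub>F n in sequentially. \<forall>a\<in>A. dist (u (s n) a) (l a) < e"
    by blast
  have "(\<lambda>n. u (s n) a) \<longlonglongrightarrow> l a" if "a \<in> A" for a
    unfolding tendsto_iff
  proof (intro allI impI)
    fix e :: real assume "e > 0"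
    from l[rule_format, OF this] show "\<forall>\<^sub>F n in sequentially. dist (u (s n) a) (l a) < e"
      by eventually_elim (use that in blast)
  qed
  with s show thesis by (rule that)
qed

text \<open>Along a coordinatewise convergent subsequence the distance of consecutive terms tends to
  0, which contradicts a positive lower bound.\<close>

lemma no_bounded_separated_sequence:
  fixes u :: "nat \<Rightarrow> 'a \<Rightarrow> real"
  assumes "finite A" and bdd: "\<And>a. a \<in> A \<Longrightarrow> \<exists>B. \<forall>n. \<bar>u n a\<bar> \<le> B"
    and "\<epsilon> > 0" and sep: "\<And>i j. i < j \<Longrightarrow> \<epsilon> \<le> L2_set (\<lambda>a. u i a - u j a) A"
  shows False
proof -
  obtain l s where s: "strict_mono s" and l: "\<And>a. a \<in> A \<Longrightarrow> (\<lambda>n. u (s n) a) \<longlonglongrightarrow> l a"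
    by (rule bounded_coordinates_subsequence[of A u]) (use assms(1,2) in auto)
  have "(\<lambda>n. L2_set (\<lambda>a. u (s n) a - u (s (Suc n)) a) A) \<longlonglongrightarrow> L2_set (\<lambda>a. l a - l a) A"
    unfolding L2_set_def
    by (intro tendsto_real_sqrt tendsto_sum tendsto_power tendsto_diff LIMSEQ_Suc l)
  moreover have "\<epsilon> \<le> L2_set (\<lambda>a. u (s n) a - u (s (Suc n)) a) A" for n
    by (intro sep strict_monoD[OF s]) simp
  ultimately have "\<epsilon> \<le> L2_set (\<lambda>a. l a - l a) A"
    by (intro LIMSEQ_le_const) auto
  then show False using \<open>\<epsilon> > 0\<close> by (simp add: L2_set_def)
qed

section \<open>Existence of maximum-margin hyperplanes\<close>

text \<open>Cauchy-Schwarz in feature space.\<close>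

lemma feature_inner_le:
  "\<bar>feature_inner X m w u\<bar> \<le> L2_set w (monomials_upto X m) * L2_set u (monomials_upto X m)"
proof -
  have "\<bar>feature_inner X m w u\<bar> \<le> (\<Sum>\<mu>\<in>monomials_upto X m. \<bar>w \<mu>\<bar> * \<bar>u \<mu>\<bar>)"
    unfolding feature_inner_def abs_mult[symmetric] by (rule sum_abs)
  then show ?thesis using L2_set_mult_ineq order_trans by blast
qed

lemma feature_inner_diff:
  "feature_inner X m w (\<lambda>\<mu>. u \<mu> - v \<mu>) = feature_inner X m w u - feature_inner X m w v"
  by (simp add: feature_inner_def algebra_simps sum_subtractf)

lemma feature_inner_uminus_left:
  "feature_inner X m (\<lambda>\<mu>. - w \<mu>) u = - feature_inner X m w u"
  by (simp add: feature_inner_def sum_negf)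

lemma feature_inner_divide_left:
  "feature_inner X m (\<lambda>\<mu>. w \<mu> / c) u = feature_inner X m w u / c"
  by (simp add: feature_inner_def sum_divide_distrib)

lemma feature_inner_normal_zero:
  assumes "finite X" "L2_set w (monomials_upto X m) = 0"
  shows "feature_inner X m w u = 0"
  using assms by (simp add: feature_inner_def L2_set_eq_0_iff finite_monomials_upto)

text \<open>Compactness of the unit sphere: the limit of a maximizing sequence attains the supremum
  of the least inner product with \<open>C\<close>. With \<open>C\<close> the set of differences of
  points of two classes, this is the direction of the widest gap.\<close>

lemma unit_normal_maximizing_least_inner:
  fixes C :: "'v fvec set"
  assumes "finite X" "finite C" "C \<noteq> {}"
  obtains w where "L2_set w (monomials_upto X m) = 1"
    "\<And>w' c. \<lbrakk> L2_set w' (monomials_upto X m) = 1; c \<in> C \<rbrakk> \<Longrightarrow>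
       (MIN c\<in>C. feature_inner X m w' c) \<le> feature_inner X m w c"
proof -
  let ?A = "monomials_upto X m"
  let ?S = "{w :: 'v fvec. L2_set w ?A = 1}"
  define h where "h w = (MIN c\<in>C. feature_inner X m w c)" for w
  have A: "finite ?A" using finite_monomials_upto[OF assms(1)] .
  have h_le: "h w \<le> feature_inner X m w c" if "c \<in> C" for w c
    unfolding h_def using assms(2) that by simp
  obtain c0 where c0: "c0 \<in> C" using assms(3) by blast
  have "h w \<le> L2_set c0 ?A" if "w \<in> ?S" for w
    using h_le[OF c0, of w] feature_inner_le[of X m w c0] that by simp
  then have bdd: "bdd_above (h ` ?S)" by (auto simp: bdd_above_def)
  have ne: "?S \<noteq> {}"
  proof -
    \<comment> \<open>The constant monomial is always a coordinate, so the sphere is nonempty even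
      for \<open>X = {}\<close>.\<close>
    have "L2_set (\<lambda>\<mu>. if \<mu> = 0 then 1 else 0) ?A = 1"
      using A by (simp add: L2_set_def if_distrib[of "\<lambda>x. x\<^sup>2"] zero_in_monomials_upto cong: if_cong)
    then show ?thesis by blast
  qed
  define M where "M = Sup (h ` ?S)"
  have "\<exists>w\<in>?S. M - 1 / real (Suc n) < h w" for n
    using less_cSup_iff[of "h ` ?S" "M - 1 / real (Suc n)"] ne bdd by (auto simp: M_def)
  then obtain W where W: "\<And>n. L2_set (W n) ?A = 1" "\<And>n. M - 1 / real (Suc n) < h (W n)"
    by (metis (mono_tags) mem_Collect_eq)
  have "\<bar>W n \<mu>\<bar> \<le> 1" if "\<mu> \<in> ?A" for n \<mu>
    using member_le_L2_set[OF A that, of "\<lambda>\<mu>. \<bar>W n \<mu>\<bar>"] W(1)[of n] by (simp add: L2_set_def)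
  then obtain l s where s: "strict_mono s" and l: "\<And>\<mu>. \<mu> \<in> ?A \<Longrightarrow> (\<lambda>n. W (s n) \<mu>) \<longlonglongrightarrow> l \<mu>"
    using bounded_coordinates_subsequence[OF A, of W] by metis
  have "(\<lambda>n. L2_set (W (s n)) ?A) \<longlonglongrightarrow> L2_set l ?A"
    unfolding L2_set_def by (intro tendsto_real_sqrt tendsto_sum tendsto_power l)
  then have l1: "L2_set l ?A = 1" by (simp add: W(1) LIMSEQ_const_iff)
  \<comment> \<open>The limit is taken for each \<open>c\<close> separately, since a lower bound for
    the minimum is a lower bound for every member.\<close>
  have M_le: "M \<le> feature_inner X m l c" if "c \<in> C" for c
  proof (rule LIMSEQ_le)
    have "(\<lambda>n. 1 / real (Suc (s n))) \<longlonglongrightarrow> 0"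
      using LIMSEQ_subseq_LIMSEQ[OF lim_1_over_n[THEN LIMSEQ_Suc] s] by (simp add: o_def)
    from tendsto_diff[OF tendsto_const[of M] this]
    show "(\<lambda>n. M - 1 / real (Suc (s n))) \<longlonglongrightarrow> M" by simp
    show "(\<lambda>n. feature_inner X m (W (s n)) c) \<longlonglongrightarrow> feature_inner X m l c"
      unfolding feature_inner_def by (intro tendsto_sum tendsto_mult tendsto_const l)
    show "\<exists>N. \<forall>n\<ge>N. M - 1 / real (Suc (s n)) \<le> feature_inner X m (W (s n)) c"
      using W(2) h_le[OF that] by (metis less_le_not_le order_less_le_trans)
  qed
  show thesis
  proof (rule that[OF l1])
    fix w' c assume "L2_set w' ?A = 1" and c: "c \<in> C"
    then have "h w' \<le> M" unfolding M_def using bdd by (intro cSup_upper) auto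
    with M_le[OF c] show "(MIN c\<in>C. feature_inner X m w' c) \<le> feature_inner X m l c"
      by (simp add: h_def)
  qed
qed

text \<open>With a zero normal the affine function is the constant \<open>b\<close>, which cannot
  have both signs.\<close>

lemma separates_normal_pos:
  assumes "finite X" "separates X m w b U V" "u \<in> U" "v \<in> V"
  shows "L2_set w (monomials_upto X m) > 0"
proof (rule ccontr)
  assume "\<not> ?thesis"
  then have "L2_set w (monomials_upto X m) = 0"
    using L2_set_nonneg[of w "monomials_upto X m"] by linarith
  with assms feature_inner_normal_zero[OF assms(1)] show False
    unfolding separates_def by force
qed

lemma functional_margin_le:
  assumes "u \<in> U" "L2_set w (monomials_upto X m) > 0"
  shows "functional_margin X m w b U
       \<le> ereal (2 * \<bar>feature_inner X m w u + b\<bar> / L2_set w (monomials_upto X m))"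
  unfolding functional_margin_def using assms by (intro INF_lower2[OF assms(1)]) simp

text \<open>For a fixed unit normal that separates the classes, the best offset lies midway between
  them and gives the width of the gap as margin. Hence only the normal has to be optimized, and the
  optimal one comes from compactness.\<close>

lemma max_margin_hyperplane_exists:
  assumes X: "finite X" and fin: "finite U" "finite V" and sep: "separates X m w\<^sub>0 b\<^sub>0 U V"
  shows "\<exists>w b. max_margin_hyperplane X m U V w b"
proof (cases "U = {} \<or> V = {}")
  case True
  \<comment> \<open>An empty class admits the hyperplane at infinity: the norm 0 in the denominator
    makes every quotient, and so the margin, infinite. The sign of \<open>c\<close> suits the class
    that may be nonempty.\<close>
  define c :: real where "c = (if V = {} then 1 else -1)"
  have "functional_margin X m (\<lambda>_. 0) c (U \<union> V) = \<infinity>"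
    by (auto simp: functional_margin_def feature_inner_def L2_set_def c_def top_ereal_def
        intro!: INF_eqI)
  moreover have "separates X m (\<lambda>_. 0) c U V"
    using True by (auto simp: separates_def feature_inner_def c_def)
  ultimately have "max_margin_hyperplane X m U V (\<lambda>_. 0) c"
    by (simp add: max_margin_hyperplane_def)
  then show ?thesis by blast
next
  case False
  let ?A = "monomials_upto X m"
  let ?f = "feature_inner X m"
  let ?D = "\<lambda>(u, v) \<mu>. u \<mu> - v \<mu> :: real"
  define C where "C = ?D ` (U \<times> V)"
  have C: "finite C" "C \<noteq> {}" using fin False by (auto simp: C_def)
  obtain w where w1: "L2_set w ?A = 1"
    and w: "\<And>w' c. \<lbrakk> L2_set w' ?A = 1; c \<in> C \<rbrakk> \<Longrightarrow> (MIN c\<in>C. ?f w' c) \<le> ?f w c"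
    using unit_normal_maximizing_least_inner[OF X C] by blast
  define p where "p = (MIN u\<in>U. ?f w u)"
  define q where "q = (MAX v\<in>V. ?f w v)"
  \<comment> \<open>The midpoint offset puts the nearest points of both classes at distance
    \<open>(p - q) / 2\<close>.\<close>
  define b where "b = - (p + q) / 2"
  have p: "p \<le> ?f w u" if "u \<in> U" for u unfolding p_def using that fin by simp
  have q: "?f w v \<le> q" if "v \<in> V" for v unfolding q_def using that fin by simp
  have "p \<in> ?f w ` U" "q \<in> ?f w ` V"
    unfolding p_def q_def using fin False by (intro Min_in Max_in; simp)+
  then obtain u1 v1 where u1: "u1 \<in> U" "p = ?f w u1" and v1: "v1 \<in> V" "q = ?f w v1"
    by blast
  have margin_w': "\<exists>u\<in>U. \<exists>v\<in>V. ?f w' u - ?f w' v \<le> L2_set w' ?A * (p - q)"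
    if n: "L2_set w' ?A > 0" for w'
  proof -
    let ?n = "L2_set w' ?A"
    have n1: "L2_set (\<lambda>\<mu>. w' \<mu> / ?n) ?A = 1"
      using L2_set_right_distrib[of "1 / ?n" w' ?A] n by simp
    \<comment> \<open>The optimal normal takes the value \<open>p - q\<close> on this difference, so
      maximality bounds the least gap for the normalized \<open>w'\<close> by
      \<open>p - q\<close>.\<close>
    have "?D (u1, v1) \<in> C" using u1 v1 unfolding C_def by blast
    from w[OF n1 this] have "(MIN c\<in>C. ?f (\<lambda>\<mu>. w' \<mu> / ?n) c) \<le> p - q"
      using u1 v1 by (simp add: feature_inner_diff)
    moreover have "(MIN c\<in>C. ?f (\<lambda>\<mu>. w' \<mu> / ?n) c) \<in> ?f (\<lambda>\<mu>. w' \<mu> / ?n) ` C"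
      using C by (intro Min_in) auto
    ultimately obtain u v where "u \<in> U" "v \<in> V" "?f (\<lambda>\<mu>. w' \<mu> / ?n) (?D (u, v)) \<le> p - q"
      unfolding C_def by auto
    then show ?thesis
      using n by (intro bexI[of _ u] bexI[of _ v])
        (simp_all add: feature_inner_divide_left feature_inner_diff field_simps)
  qed
  \<comment> \<open>The given \<open>w\<^sub>0\<close> has a positive gap on every pair of points,
    so the optimal gap is positive too.\<close>
  have pos: "p - q > 0"
  proof -
    have n: "L2_set w\<^sub>0 ?A > 0" using separates_normal_pos[OF X sep] False by blast
    from margin_w'[OF this] sep have "0 < L2_set w\<^sub>0 ?A * (p - q)"
      unfolding separates_def by force
    with n show ?thesis by (simp add: zero_less_mult_iff)
  qed
  have fu: "?f w u + b \<ge> (p - q) / 2" if "u \<in> U" for u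
    using p[OF that] by (simp add: b_def field_simps)
  have fv: "?f w v + b \<le> - (p - q) / 2" if "v \<in> V" for v
    using q[OF that] by (simp add: b_def field_simps)
  have "separates X m w b U V"
    unfolding separates_def using fu fv pos by force
  moreover have "ereal (p - q) \<le> functional_margin X m w b (U \<union> V)"
    unfolding functional_margin_def w1
  proof (rule INF_greatest)
    fix u assume "u \<in> U \<union> V"
    then have "p - q \<le> 2 * \<bar>?f w u + b\<bar>" using fu[of u] fv[of u] pos by auto
    then show "ereal (p - q) \<le> ereal (2 * \<bar>?f w u + b\<bar>) / ereal 1" by simp
  qed
  moreover have "functional_margin X m w' b' (U \<union> V) \<le> ereal (p - q)"
    if s: "separates X m w' b' U V" for w' b'
  proof -
    let ?n = "L2_set w' ?A"
    have n: "?n > 0" using separates_normal_pos[OF X s] False by blast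
    obtain u v where uv: "u \<in> U" "v \<in> V" "?f w' u - ?f w' v \<le> ?n * (p - q)"
      using margin_w'[OF n] by blast
    have "?f w' u + b' > 0" "?f w' v + b' < 0" using s uv by (auto simp: separates_def)
    \<comment> \<open>The two values have opposite signs and their absolute values add up to the
      gap, so the smaller one is at most half of it.\<close>
    then have "2 * \<bar>?f w' u + b'\<bar> \<le> ?n * (p - q) \<or> 2 * \<bar>?f w' v + b'\<bar> \<le> ?n * (p - q)"
      using uv(3) by (cases "?f w' u + b' \<le> - (?f w' v + b')") simp_all
    then obtain z where z: "z \<in> U \<union> V" "2 * \<bar>?f w' z + b'\<bar> \<le> ?n * (p - q)" using uv by blast
    have "2 * \<bar>?f w' z + b'\<bar> / ?n \<le> p - q" using z(2) n by (simp add: field_simps)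
    with functional_margin_le[OF z(1) n, of b'] show ?thesis
      by (meson ereal_less_eq(3) order_trans)
  qed
  ultimately show ?thesis unfolding max_margin_hyperplane_def by (meson order_trans)
qed

section \<open>Symmetry and monotonicity of margins; distance of misclassified points\<close>

text \<open>Reversing the orientation allows the projected solutions of \<phi> to be placed on the
  positive side.\<close>

lemma separates_uminus:
  "separates X m (\<lambda>\<mu>. - w \<mu>) (- b) U V \<longleftrightarrow> separates X m w b V U"
  by (auto simp: separates_def feature_inner_uminus_left)

lemma functional_margin_uminus:
  "functional_margin X m (\<lambda>\<mu>. - w \<mu>) (- b) U = functional_margin X m w b U"
proof -
  have "\<bar>- feature_inner X m w u - b\<bar> = \<bar>feature_inner X m w u + b\<bar>" for u by linarith
  then show ?thesis
    by (simp add: functional_margin_def feature_inner_uminus_left L2_set_def)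
qed

lemma functional_margin_antimono:
  "U \<subseteq> V \<Longrightarrow> functional_margin X m w b V \<le> functional_margin X m w b U"
  unfolding functional_margin_def by (rule INF_superset_mono) auto

lemma separates_subset:
  "\<lbrakk> separates X m w b U V; U' \<subseteq> U; V' \<subseteq> V \<rbrakk> \<Longrightarrow> separates X m w b U' V'"
  by (auto simp: separates_def)

text \<open>Between \<open>u\<close> and \<open>x\<close> the affine function changes by at least
  its absolute value at \<open>u\<close>, which the margin bounds from below; Cauchy-Schwarz turns
  this change into a distance. The factor 1/2 appears because the functional margin is twice the
  distance.\<close>

lemma wrong_side_distance:
  assumes X: "finite X" and margin: "ereal \<gamma> \<le> functional_margin X m w b U" and "u \<in> U"
    and side: "feature_inner X m w u + b > 0 \<and> feature_inner X m w x + b \<le> 0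
             \<or> feature_inner X m w u + b < 0 \<and> feature_inner X m w x + b \<ge> 0"
  shows "\<gamma> / 2 \<le> L2_set (\<lambda>\<mu>. u \<mu> - x \<mu>) (monomials_upto X m)"
proof -
  let ?n = "L2_set w (monomials_upto X m)"
  \<comment> \<open>A zero normal would give \<open>u\<close> and \<open>x\<close> the same value
    \<open>b\<close>.\<close>
  have "?n \<noteq> 0" using side feature_inner_normal_zero[OF X] by fastforce
  then have n: "?n > 0" using L2_set_nonneg[of w "monomials_upto X m"] by linarith
  from margin functional_margin_le[OF \<open>u \<in> U\<close> n, of b]
  have "\<gamma> \<le> 2 * \<bar>feature_inner X m w u + b\<bar> / ?n" by (meson ereal_less_eq(3) order_trans)
  then have "?n * (\<gamma> / 2) \<le> \<bar>feature_inner X m w u + b\<bar>" using n by (simp add: field_simps)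
  also have "\<dots> \<le> \<bar>feature_inner X m w (\<lambda>\<mu>. u \<mu> - x \<mu>)\<bar>"
    using side unfolding feature_inner_diff by linarith
  also have "\<dots> \<le> ?n * L2_set (\<lambda>\<mu>. u \<mu> - x \<mu>) (monomials_upto X m)" by (rule feature_inner_le)
  finally show ?thesis using n by simp
qed

section \<open>Formulas and projected solutions\<close>

lemma finite_fvars: "finite (fvars f)"
  by (induction f) (auto simp: poly_vars_def)

lemma mono_eval_cong:
  "(\<And>v. v \<in> Poly_Mapping.keys \<mu> \<Longrightarrow> \<sigma> v = \<tau> v) \<Longrightarrow> mono_eval \<sigma> \<mu> = mono_eval \<tau> \<mu>"
  by (simp add: mono_eval_def)

lemma poly_eval_cong:
  "(\<And>v. v \<in> poly_vars p \<Longrightarrow> \<sigma> v = \<tau> v) \<Longrightarrow> poly_eval \<sigma> p = poly_eval \<tau> p"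
  unfolding poly_eval_def poly_vars_def
  by (intro sum.cong refl arg_cong2[where f = "(*)"] mono_eval_cong) auto

lemma holds_cong:
  "(\<And>v. v \<in> fvars f \<Longrightarrow> \<sigma> v = \<tau> v) \<Longrightarrow> holds \<sigma> f = holds \<tau> f"
proof (induction f)
  case (Atom r p)
  then have "poly_eval \<sigma> p = poly_eval \<tau> p" by (intro poly_eval_cong) auto
  then show ?case by simp
qed auto

text \<open>Truth depends only on the free variables, so arbitrary valuations can replace the
  extensional points of \<open>solutions f\<close>.\<close>

lemma proj_solutions_eq_restrict:
  assumes "X \<subseteq> fvars f"
  shows "proj_solutions X f = (\<lambda>\<sigma>. restrict \<sigma> X) ` {\<sigma>. holds \<sigma> f}"
proof (intro equalityI subsetI)
  fix x assume "x \<in> (\<lambda>\<sigma>. restrict \<sigma> X) ` {\<sigma>. holds \<sigma> f}"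
  then obtain \<sigma> where \<sigma>: "holds \<sigma> f" "x = restrict \<sigma> X" by blast
  have "restrict \<sigma> (fvars f) \<in> {\<sigma> \<in> fvars f \<rightarrow>\<^sub>E UNIV. holds \<sigma> f}"
    using \<sigma>(1) holds_cong[of f \<sigma> "restrict \<sigma> (fvars f)"] by simp
  moreover have "x = restrict (restrict \<sigma> (fvars f)) X"
    using assms \<sigma>(2) by (simp add: Int_absorb1)
  ultimately show "x \<in> proj_solutions X f"
    unfolding proj_solutions_def solutions_def by blast
qed (auto simp: proj_solutions_def solutions_def)

lemma feature_map_restrict: "feature_map X \<beta> \<theta> m (restrict \<sigma> X) = feature_map X \<beta> \<theta> m \<sigma>"
  unfolding feature_map_def
  by (intro restrict_ext arg_cong2[where f = "(*)"] refl mono_eval_cong)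
    (auto simp: monomials_upto_def)

text \<open>Each coordinate of a solution is at most its norm, so each monomial is bounded by a
  product of powers of the norm bound.\<close>

lemma bounded_solutions_feature_bound:
  assumes "bounded_solutions f" "X \<subseteq> fvars f"
  shows "\<exists>B. \<forall>x\<in>proj_solutions X f. \<bar>feature_map X \<beta> \<theta> m x \<mu>\<bar> \<le> B"
proof (cases "\<mu> \<in> monomials_upto X m")
  case True
  obtain B where B: "\<And>\<sigma>. \<sigma> \<in> solutions f \<Longrightarrow> L2_set \<sigma> (fvars f) \<le> B"
    using assms(1) unfolding bounded_solutions_def by blast
  have "\<bar>feature_map X \<beta> \<theta> m x \<mu>\<bar>
      \<le> \<bar>feature_weight \<beta> \<theta> m \<mu>\<bar> * (\<Prod>v\<in>Poly_Mapping.keys \<mu>. B ^ Poly_Mapping.lookup \<mu> v)"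
    if x: "x \<in> proj_solutions X f" for x
  proof -
    obtain \<sigma> where \<sigma>: "\<sigma> \<in> solutions f" "x = restrict \<sigma> X"
      using x unfolding proj_solutions_def by blast
    have "\<bar>\<sigma> v\<bar> \<le> B" if "v \<in> Poly_Mapping.keys \<mu>" for v
    proof -
      have "v \<in> fvars f" using that True assms(2) by (auto simp: monomials_upto_def)
      from member_le_L2_set[OF finite_fvars this, of "\<lambda>v. \<bar>\<sigma> v\<bar>"] B[OF \<sigma>(1)]
      show ?thesis by (simp add: L2_set_def)
    qed
    then have "\<bar>mono_eval \<sigma> \<mu>\<bar> \<le> (\<Prod>v\<in>Poly_Mapping.keys \<mu>. B ^ Poly_Mapping.lookup \<mu> v)"
      unfolding mono_eval_def abs_prod power_abs by (intro prod_mono) (auto intro: power_mono)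
    then show ?thesis
      using True unfolding \<sigma>(2) feature_map_restrict
      by (simp add: feature_map_def abs_mult mult_left_mono)
  qed
  then show ?thesis by blast
\<comment> \<open>Off \<open>monomials_upto X m\<close> the coordinate has the same default value
  for all \<open>x\<close>.\<close>
qed (auto simp: feature_map_def)

lemma fvars_hyperplane_atom:
  assumes "finite X"
  shows "fvars (Atom r (hyperplane_poly X \<beta> \<theta> m w b)) \<subseteq> X"
  using hyperplane_poly_in_polys_upto[OF assms, of \<beta> \<theta> m w b]
  by (auto simp: poly_vars_def polys_upto_def monomials_upto_def)

lemma interpolant_imp_unsat: "interpolant \<phi> \<psi> I \<Longrightarrow> \<not> satisfiable (And \<phi> \<psi>)"
  by (auto simp: interpolant_def entails_def satisfiable_def)

section \<open>The refinement loop\<close>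

text \<open>The normalized situation: \<phi> is on the positive side, and \<gamma> is a real lower
  bound of the margin, which also covers an infinite margin.\<close>

locale separable_instance =
  fixes \<phi> \<psi> :: "'v fm" and X :: "'v set" and m :: nat and \<beta> \<theta> :: real
    and w :: "'v fvec" and b \<gamma> :: real
  assumes X_eq: "X = common_vars \<phi> \<psi>"
    and bounded: "bounded_solutions \<phi>" "bounded_solutions \<psi>"
    and unsat: "\<not> satisfiable (And \<phi> \<psi>)"
    and separation: "separates X m w b (feature_map X \<beta> \<theta> m ` proj_solutions X \<phi>)
                                       (feature_map X \<beta> \<theta> m ` proj_solutions X \<psi>)"
    and margin: "ereal \<gamma> \<le> functional_margin X m w b
                   (feature_map X \<beta> \<theta> m ` (proj_solutions X \<phi> \<union> proj_solutions X \<psi>))"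
    and gamma_pos: "\<gamma> > 0"
begin

abbreviation "F \<equiv> feature_map X \<beta> \<theta> m"
abbreviation "A \<equiv> monomials_upto X m"
abbreviation "step \<equiv> nil_step \<beta> \<theta> \<phi> \<psi> m"

lemma X_subset: "X \<subseteq> fvars \<phi>" "X \<subseteq> fvars \<psi>" "finite X"
  using finite_fvars by (auto simp: X_eq common_vars_def)

text \<open>The non-strict conclusions cover both the strict and the non-strict choice of
  \<open>r\<close>.\<close>

lemma refinement_samples:
  assumes "r \<in> {Gt, Ge}" and I: "I = Atom r (hyperplane_poly X \<beta> \<theta> m w' b')"
  shows "x \<in> proj_solutions X (And \<phi> (Neg I)) \<Longrightarrow>
           x \<in> proj_solutions X \<phi> \<and> feature_inner X m w' (F x) + b' \<le> 0"
    and "x \<in> proj_solutions X (And I \<psi>) \<Longrightarrow>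
           x \<in> proj_solutions X \<psi> \<and> feature_inner X m w' (F x) + b' \<ge> 0"
proof -
  have X: "X \<subseteq> fvars (And \<phi> (Neg I))" "X \<subseteq> fvars (And I \<psi>)" using X_subset by auto
  show "x \<in> proj_solutions X \<phi> \<and> feature_inner X m w' (F x) + b' \<le> 0"
    if "x \<in> proj_solutions X (And \<phi> (Neg I))"
    using that assms unfolding proj_solutions_eq_restrict[OF X(1)] proj_solutions_eq_restrict[OF X_subset(1)]
    by (auto simp: feature_map_restrict poly_eval_hyperplane_poly X_subset(3))
  show "x \<in> proj_solutions X \<psi> \<and> feature_inner X m w' (F x) + b' \<ge> 0"
    if "x \<in> proj_solutions X (And I \<psi>)"
    using that assms unfolding proj_solutions_eq_restrict[OF X(2)] proj_solutions_eq_restrict[OF X_subset(2)]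
    by (auto simp: feature_map_restrict poly_eval_hyperplane_poly X_subset(3))
qed

text \<open>The invariant of all runs. As \<open>Aborted\<close> is not good, its preservation rules
  out aborting.\<close>

fun good :: "'v nil_state \<Rightarrow> bool" where
  "good Start \<longleftrightarrow> True"
| "good (Loop P N) \<longleftrightarrow> finite P \<and> P \<subseteq> proj_solutions X \<phi> \<and> finite N \<and> N \<subseteq> proj_solutions X \<psi>"
| "good (Returned I) \<longleftrightarrow> interpolant \<phi> \<psi> I"
| "good Aborted \<longleftrightarrow> False"

lemma samples_separated:
  assumes "good (Loop P N)"
  shows "separates X m w b (F ` P) (F ` N)"
  using separation by (rule separates_subset) (use assms in auto)

lemma samples_max_margin_exists:
  assumes "good (Loop P N)"
  obtains w' b' where "max_margin_hyperplane X m (F ` P) (F ` N) w' b'"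
  using max_margin_hyperplane_exists[OF X_subset(3) _ _ samples_separated[OF assms]] assms by auto

text \<open>The start cannot abort by \<open>unsat\<close>, and the SVM cannot abort because the
  given hyperplane separates all samples. The free variables of a returned atom are common because
  its polynomial uses only variables in \<open>X\<close>.\<close>

lemma good_step:
  assumes "step s t" "good s"
  shows "good t"
  using assms
proof (cases rule: nil_step.cases)
  case (svm_abort X' P N)
  then show ?thesis using samples_max_margin_exists[of P N] assms(2) X_eq by metis
next
  case (svm_return X' P N w' b' r I)
  then have "fvars I \<subseteq> common_vars \<phi> \<psi>"
    using fvars_hyperplane_atom[OF X_subset(3)] X_eq by blast
  with svm_return show ?thesis by (simp add: interpolant_def del: fvars.simps)
next
  case (svm_refine X' P N w' b' r I P' N')
  have I: "I = Atom r (hyperplane_poly X \<beta> \<theta> m w' b')" using svm_refine X_eq by simp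
  have "P' \<subseteq> proj_solutions X \<phi>" "N' \<subseteq> proj_solutions X \<psi>"
    using refinement_samples[OF \<open>r \<in> {Gt, Ge}\<close> I] svm_refine X_eq by blast+
  with svm_refine assms(2) show ?thesis by simp
qed (use unsat in \<open>auto simp: X_eq[symmetric]\<close>)

text \<open>Every good state that has not returned has some successor: either the candidate is an
  interpolant, or a counterexample exists and can be sampled.\<close>

lemma good_progress:
  assumes "good s" "\<nexists>t. step s t"
  shows "\<exists>I. s = Returned I \<and> interpolant \<phi> \<psi> I"
proof (cases s)
  case Start
  have "step Start (Loop {} {})" using unsat by (intro start_sample) auto
  with assms(2) Start show ?thesis by blast
next
  case (Loop P N)
  obtain w' b' where max: "max_margin_hyperplane X m (F ` P) (F ` N) w' b'"
    using samples_max_margin_exists assms(1) Loop by blast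
  define I where "I = Atom Gt (hyperplane_poly X \<beta> \<theta> m w' b')"
  show ?thesis
  proof (cases "entails \<phi> I \<and> \<not> satisfiable (And I \<psi>)")
    case True
    then have "step s (Returned I)"
      unfolding Loop using svm_return[OF X_eq max _ I_def] by blast
    with assms(2) show ?thesis by blast
  next
    case False
    have X: "X \<subseteq> fvars (And \<phi> (Neg I))" "X \<subseteq> fvars (And I \<psi>)" using X_subset by auto
    from False have "(\<exists>\<sigma>. holds \<sigma> (And \<phi> (Neg I))) \<or> (\<exists>\<sigma>. holds \<sigma> (And I \<psi>))"
      by (auto simp: entails_def satisfiable_def)
    then have "(\<exists>x. x \<in> proj_solutions X (And \<phi> (Neg I))) \<or> (\<exists>x. x \<in> proj_solutions X (And I \<psi>))"
      unfolding proj_solutions_eq_restrict[OF X(1)] proj_solutions_eq_restrict[OF X(2)] by blast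
    \<comment> \<open>For instance, a single counterexample on one side and the empty set on the
      other.\<close>
    then obtain P' N' where "finite P'" "P' \<subseteq> proj_solutions X (And \<phi> (Neg I))"
      "finite N'" "N' \<subseteq> proj_solutions X (And I \<psi>)" "P' \<union> N' \<noteq> {}"
      by (metis Un_empty empty_not_insert empty_subsetI finite.emptyI finite.insertI
          insert_subset)
    then have "step s (Loop (P \<union> P') (N \<union> N'))"
      unfolding Loop using svm_refine[OF X_eq max _ I_def False] by blast
    with assms(2) show ?thesis by blast
  qed
qed (use assms(1) in auto)

section \<open>Termination by separation of new samples\<close>

definition far :: "('v \<Rightarrow> real) \<Rightarrow> ('v \<Rightarrow> real) set \<Rightarrow> bool" where
  "far x P \<longleftrightarrow> (\<forall>y\<in>P. \<gamma> / 2 \<le> L2_set (\<lambda>\<mu>. F y \<mu> - F x \<mu>) A)"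

text \<open>Passing from all solutions to the samples can only raise the margin of the given
  hyperplane, and the maximum-margin one does no worse, so its margin is at least \<gamma>. A
  counterexample lies on its wrong side or on it, hence far from the old samples of its
  class.\<close>

lemma refinement_step:
  assumes "step (Loop P N) (Loop P\<^sub>1 N\<^sub>1)" and good: "good (Loop P N)"
  shows "P \<subseteq> P\<^sub>1 \<and> N \<subseteq> N\<^sub>1 \<and> ((\<exists>x\<in>P\<^sub>1. far x P) \<or> (\<exists>x\<in>N\<^sub>1. far x N))"
  using assms(1)
proof (cases rule: nil_step.cases)
  case (svm_refine X' w' b' r I P' N')
  have I: "I = Atom r (hyperplane_poly X \<beta> \<theta> m w' b')"
    and sub: "P' \<subseteq> proj_solutions X (And \<phi> (Neg I))" "N' \<subseteq> proj_solutions X (And I \<psi>)"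
    and max: "max_margin_hyperplane X m (F ` P) (F ` N) w' b'"
    using svm_refine X_eq by simp_all
  let ?S = "F ` P \<union> F ` N"
  have "functional_margin X m w b (F ` (proj_solutions X \<phi> \<union> proj_solutions X \<psi>))
      \<le> functional_margin X m w b ?S"
    using good by (intro functional_margin_antimono) auto
  moreover have "functional_margin X m w b ?S \<le> functional_margin X m w' b' ?S"
    using max samples_separated[OF good] unfolding max_margin_hyperplane_def by blast
  ultimately have marg: "ereal \<gamma> \<le> functional_margin X m w' b' ?S"
    using margin by (meson order_trans)
  have sep: "separates X m w' b' (F ` P) (F ` N)"
    using max unfolding max_margin_hyperplane_def by blast
  have "far x P" if "x \<in> P'" for x
    unfolding far_def
  proof
    fix y assume "y \<in> P"
    with sep that sub(1) refinement_samples(1)[OF \<open>r \<in> {Gt, Ge}\<close> I, of x]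
    show "\<gamma> / 2 \<le> L2_set (\<lambda>\<mu>. F y \<mu> - F x \<mu>) A"
      by (intro wrong_side_distance[OF X_subset(3) marg]) (auto simp: separates_def)
  qed
  moreover have "far x N" if "x \<in> N'" for x
    unfolding far_def
  proof
    fix y assume "y \<in> N"
    with sep that sub(2) refinement_samples(2)[OF \<open>r \<in> {Gt, Ge}\<close> I, of x]
    show "\<gamma> / 2 \<le> L2_set (\<lambda>\<mu>. F y \<mu> - F x \<mu>) A"
      by (intro wrong_side_distance[OF X_subset(3) marg]) (auto simp: separates_def)
  qed
  ultimately show ?thesis using svm_refine by blast
qed

text \<open>One far point from each such index would form an infinite sequence with mutual distances
  at least \<open>\<gamma> / 2\<close>, although the features of the solutions are bounded.\<close>

lemma finitely_many_far_samples:
  fixes Q :: "nat \<Rightarrow> ('v \<Rightarrow> real) set"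
  assumes f: "bounded_solutions f" "X \<subseteq> fvars f"
    and Q: "\<And>i. Q i \<subseteq> proj_solutions X f" "\<And>i. Q i \<subseteq> Q (Suc i)"
  shows "finite {i. \<exists>x\<in>Q (Suc i). far x (Q i)}" (is "finite ?J")
proof (rule ccontr)
  assume inf: "infinite ?J"
  define e where "e = enumerate ?J"
  have e: "strict_mono e" "\<And>i. e i \<in> ?J"
    using inf by (auto simp: e_def strict_mono_enumerate dest: enumerate_in_set[of ?J])
  then obtain x where x: "\<And>i. x i \<in> Q (Suc (e i))" "\<And>i. far (x i) (Q (e i))"
    by (simp add: Bex_def) metis
  have mono: "Q i \<subseteq> Q j" if "i \<le> j" for i j using lift_Suc_mono_le[of Q, OF Q(2) that] .
  show False
  proof (rule no_bounded_separated_sequence[of A "\<lambda>i. F (x i)" "\<gamma> / 2"])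
    show "\<exists>B. \<forall>i. \<bar>F (x i) \<mu>\<bar> \<le> B" for \<mu>
      using bounded_solutions_feature_bound[OF f, of \<beta> \<theta> m \<mu>] x(1) Q(1) by (meson subsetD)
    show "\<gamma> / 2 \<le> L2_set (\<lambda>\<mu>. F (x i) \<mu> - F (x j) \<mu>) A" if "i < j" for i j
    proof -
      \<comment> \<open>The point \<open>x i\<close> enters only at index \<open>Suc (e i)\<close>;
        by strictness of \<open>e\<close> it is already present at \<open>e j\<close>.\<close>
      have "Suc (e i) \<le> e j" using strict_monoD[OF e(1) that] by simp
      then have "x i \<in> Q (e j)" using x(1) mono by blast
      with x(2)[of j] show ?thesis unfolding far_def by blast
    qed
  qed (use gamma_pos finite_monomials_upto[OF X_subset(3)] in auto)
qed

text \<open>An infinite run refines forever. Each refinement adds a far point to one of the two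
  classes, but each class admits this only finitely often.\<close>

lemma no_infinite_run:
  assumes "run 0 = Start" and run: "\<And>i. step (run i) (run (Suc i))"
  shows False
proof -
  have good: "good (run i)" for i
    by (induction i) (use assms good_step in auto)
  \<comment> \<open>\<open>Start\<close> is never re-entered, \<open>Returned\<close> has no
    successor, and \<open>Aborted\<close> is not good.\<close>
  have "\<exists>P N. run (Suc i) = Loop P N" for i
  proof (cases "run (Suc i)")
    case Start
    then show ?thesis using run[of i] by (auto elim: nil_step.cases)
  next
    case (Returned I)
    then show ?thesis using run[of "Suc i"] by (auto elim: nil_step.cases)
  qed (use good[of "Suc i"] in auto)
  then obtain P N where PN: "\<And>i. run (Suc i) = Loop (P i) (N i)" by metis
  have sol: "P i \<subseteq> proj_solutions X \<phi>" "N i \<subseteq> proj_solutions X \<psi>" for i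
    using good[of "Suc i"] by (auto simp: PN)
  have ref: "P i \<subseteq> P (Suc i) \<and> N i \<subseteq> N (Suc i) \<and>
      ((\<exists>x\<in>P (Suc i). far x (P i)) \<or> (\<exists>x\<in>N (Suc i). far x (N i)))" for i
    using refinement_step run[of "Suc i"] good[of "Suc i"] unfolding PN by blast
  have "finite {i. \<exists>x\<in>P (Suc i). far x (P i)}"
    by (rule finitely_many_far_samples[OF bounded(1) X_subset(1) sol(1)]) (use ref in blast)
  moreover have "finite {i. \<exists>x\<in>N (Suc i). far x (N i)}"
    by (rule finitely_many_far_samples[OF bounded(2) X_subset(2) sol(2)]) (use ref in blast)
  ultimately have "finite ({i. \<exists>x\<in>P (Suc i). far x (P i)} \<union> {i. \<exists>x\<in>N (Suc i). far x (N i)})" by blast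
  moreover have "{i. \<exists>x\<in>P (Suc i). far x (P i)} \<union> {i. \<exists>x\<in>N (Suc i). far x (N i)} = UNIV"
    using ref by blast
  ultimately show False by simp
qed

text \<open>As sampling is nondeterministic, the claim concerns all runs: none is infinite, and
  every reachable state without successor is a returned interpolant.\<close>

lemma terminates_with_interpolant:
  "(\<nexists>run. run 0 = Start \<and> (\<forall>i. step (run i) (run (Suc i)))) \<and>
   (\<forall>s. step\<^sup>*\<^sup>* Start s \<and> (\<nexists>t. step s t) \<longrightarrow> (\<exists>I. s = Returned I \<and> interpolant \<phi> \<psi> I))"
proof (intro conjI allI impI)
  fix s assume s: "step\<^sup>*\<^sup>* Start s \<and> (\<nexists>t. step s t)"
  have "good s" using conjunct1[OF s] by induction (auto intro: good_step)
  with s show "\<exists>I. s = Returned I \<and> interpolant \<phi> \<psi> I" using good_progress by blast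
qed (use no_infinite_run in blast)

end

theorem theorem2:
  fixes \<phi> \<psi> I\<^sub>0 :: "'v fm" and X :: "'v set" and m :: nat and \<beta> \<theta> :: real
    and r :: cmp and p :: "'v rpoly" and w :: "'v fvec" and b :: real and \<gamma> :: ereal
  assumes common: "X = common_vars \<phi> \<psi>"
    and m: "m > 0" and kernel: "\<beta> > 0" "\<theta> > 0"
    and bounded: "bounded_solutions \<phi>" "bounded_solutions \<psi>"
    and I\<^sub>0: "interpolant \<phi> \<psi> I\<^sub>0" "I\<^sub>0 = Atom r p" "p \<in> polys_upto X m"
    and hyperplane: "p = hyperplane_poly X \<beta> \<theta> m w b"
    and separation:
      "separates X m w b (feature_map X \<beta> \<theta> m ` proj_solutions X \<phi>)
                         (feature_map X \<beta> \<theta> m ` proj_solutions X \<psi>) \<or>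
       separates X m w b (feature_map X \<beta> \<theta> m ` proj_solutions X \<psi>)
                         (feature_map X \<beta> \<theta> m ` proj_solutions X \<phi>)"
    and margin:
      "\<gamma> = functional_margin X m w b
             (feature_map X \<beta> \<theta> m ` (proj_solutions X \<phi> \<union> proj_solutions X \<psi>))"
      "\<gamma> > 0"
  shows "(\<nexists>run. run 0 = Start \<and> (\<forall>i. nil_step \<beta> \<theta> \<phi> \<psi> m (run i) (run (Suc i)))) \<and>
         (\<forall>s. (nil_step \<beta> \<theta> \<phi> \<psi> m)\<^sup>*\<^sup>* Start s \<and> (\<nexists>t. nil_step \<beta> \<theta> \<phi> \<psi> m s t)
              \<longrightarrow> (\<exists>I. s = Returned I \<and> interpolant \<phi> \<psi> I))"
proof -
  \<comment> \<open>The margin may be infinite, so a positive real below it is used.\<close>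
  obtain g :: real where g: "g > 0" "ereal g \<le> \<gamma>"
    using ereal_dense2[OF margin(2)] by (auto intro: less_imp_le)
  \<comment> \<open>If \<phi> lies on the negative side, both the normal and the offset are negated,
    which keeps the margin.\<close>
  from separation obtain w' b' where
    "separates X m w' b' (feature_map X \<beta> \<theta> m ` proj_solutions X \<phi>)
                         (feature_map X \<beta> \<theta> m ` proj_solutions X \<psi>)"
    "functional_margin X m w' b' (feature_map X \<beta> \<theta> m ` (proj_solutions X \<phi> \<union> proj_solutions X \<psi>)) = \<gamma>"
    using margin(1) separates_uminus functional_margin_uminus by metis
  then interpret separable_instance \<phi> \<psi> X m \<beta> \<theta> w' b' g
    by unfold_locales (use common bounded g interpolant_imp_unsat[OF I\<^sub>0(1)] in auto)
  show ?thesis by (rule terminates_with_interpolant)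
qed

end
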